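(* Let $n\geq 5$, let $B_n'$ be the commutator subgroup of the braid group $B_n$ on $n$ strands, and let $G$ be a finite group. If $f\colon B_n'\rightarrow G$ is not the trivial homomorphism, then \[ |G| \geq 2^{\lfloor n/2\rfloor-2}\left(\lfloor n/2\rfloor-1\right)!. \] *)

theory Defs
  imports "HOL-Algebra.Algebra"
begin

text \<open>Braid group B_n via its standard Artin presentation.
  A letter (i, True) stands for sigma_i, (i, False) for its inverse, 1 <= i <= n-1.\<close>

type_synonym braid_word = "(nat \<times> bool) list"

definition braid_valid :: "nat \<Rightarrow> braid_word \<Rightarrow> bool" where
  "braid_valid n w \<longleftrightarrow> (\<forall>x \<in> set w. 1 \<le> fst x \<and> fst x < n)"

inductive braid_eq :: "nat \<Rightarrow> braid_word \<Rightarrow> braid_word \<Rightarrow> bool" for n :: nat where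
  refl: "braid_valid n w \<Longrightarrow> braid_eq n w w"
| sym: "braid_eq n u v \<Longrightarrow> braid_eq n v u"
| trans: "braid_eq n u v \<Longrightarrow> braid_eq n v w \<Longrightarrow> braid_eq n u w"
| ctxt: "braid_eq n u v \<Longrightarrow> braid_valid n a \<Longrightarrow> braid_valid n b \<Longrightarrow>
          braid_eq n (a @ u @ b) (a @ v @ b)"
| cancel: "1 \<le> i \<Longrightarrow> i < n \<Longrightarrow> braid_eq n [(i, e), (i, \<not> e)] []"
| far: "1 \<le> i \<Longrightarrow> i < n \<Longrightarrow> 1 \<le> j \<Longrightarrow> j < n \<Longrightarrow> i + 2 \<le> j \<Longrightarrow>
          braid_eq n [(i, True), (j, True)] [(j, True), (i, True)]"
| adj: "1 \<le> i \<Longrightarrow> i + 1 < n \<Longrightarrow>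
          braid_eq n [(i, True), (i + 1, True), (i, True)] [(i + 1, True), (i, True), (i + 1, True)]"

definition braid_class :: "nat \<Rightarrow> braid_word \<Rightarrow> braid_word set" where
  "braid_class n w = {v. braid_eq n w v}"

definition braid_group :: "nat \<Rightarrow> braid_word set monoid" where
  "braid_group n = \<lparr> carrier = {braid_class n w | w. braid_valid n w},
     monoid.mult = (\<lambda>A1 A2. {w. \<exists>u \<in> A1. \<exists>v \<in> A2. braid_eq n (u @ v) w}),
     one = braid_class n [] \<rparr>"

definition braid_commutator_group :: "nat \<Rightarrow> braid_word set monoid" where
  "braid_commutator_group n =
     (braid_group n)\<lparr> carrier := derived (braid_group n) (carrier (braid_group n)) \<rparr>"

end

theory Submission
  imports Defs "HOL-Combinatorics.Permutations"
begin

text \<open>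
  The elements \<open>\<sigma>\<^sub>3\<sigma>\<^sub>1\<^sup>-\<^sup>1, \<sigma>\<^sub>5\<sigma>\<^sub>1\<^sup>-\<^sup>1, \<dots>\<close>, of which there are \<open>k = \<lfloor>n/2\<rfloor> - 1\<close>, commute pairwise, and every
  permutation of them is a conjugation in \<open>B\<^sub>n'\<close>: the braid that permutes them commutes with
  \<open>\<sigma>\<^sub>1\<close> and is moved into \<open>B\<^sub>n'\<close> by a power of \<open>\<sigma>\<^sub>1\<close>. If \<open>f\<close> identifies two of them, then it
  identifies the first two, so it kills \<open>\<sigma>\<^sub>3\<sigma>\<^sub>5\<^sup>-\<^sup>1\<close> and all its conjugates in \<open>B\<^sub>n\<close>; modulo these all
  generators coincide, so \<open>f\<close> is trivial. Otherwise the images \<open>x\<^sub>0, \<dots>, x\<^bsub>k-1\<^esub>\<close> are distinct, and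
  with \<open>g\<^sub>\<pi>\<close> realizing the permutation \<open>\<pi>\<close> the elements \<open>g\<^sub>\<pi> \<Prod>\<^bsub>i\<in>I\<^esub> x\<^sub>i\<close> for
  \<open>I \<subseteq> {0, \<dots>, k - 2}\<close> are pairwise distinct, \<open>k! 2\<^bsup>k-1\<^esup>\<close> in number.
\<close>

section \<open>Conjugation written as an intertwining relation, and the braid relation in a
  group\<close>

context group
begin

text \<open>Conjugation y = g x g^-1 is written \<open>g \<otimes> x = y \<otimes> g\<close>
  throughout, which avoids inverses and contains commutation as the case x = y.\<close>

lemma intertwine_comp:
  assumes "g \<otimes> x = y \<otimes> g" "h \<otimes> y = z \<otimes> h"
    and "g \<in> carrier G" "h \<in> carrier G" "x \<in> carrier G" "y \<in> carrier G" "z \<in> carrier G"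
  shows "(h \<otimes> g) \<otimes> x = z \<otimes> (h \<otimes> g)"
  using assms by (metis m_assoc)

lemma intertwine_mult:
  assumes "g \<otimes> x = y \<otimes> g" "g \<otimes> x' = y' \<otimes> g"
    and "g \<in> carrier G" "x \<in> carrier G" "y \<in> carrier G" "x' \<in> carrier G" "y' \<in> carrier G"
  shows "g \<otimes> (x \<otimes> x') = (y \<otimes> y') \<otimes> g"
  using assms by (metis m_assoc)

lemma intertwine_inv:
  assumes "g \<otimes> x = y \<otimes> g" "g \<in> carrier G" "x \<in> carrier G" "y \<in> carrier G"
  shows "g \<otimes> inv x = inv y \<otimes> g"
  using assms by (metis inv_closed inv_solve_left inv_solve_right m_assoc m_closed)

lemma inv_mult_cancel: "a \<in> carrier G \<Longrightarrow> b \<in> carrier G \<Longrightarrow> inv a \<otimes> (a \<otimes> b) = b"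
  by (simp add: m_assoc[symmetric])

text \<open>For three consecutive Artin generators a, b, c the element
  \<open>b \<otimes> a \<otimes> c \<otimes> b\<close> is the braid that passes one pair of parallel
  strands across the next pair, so it exchanges the crossings a and c of the two pairs.\<close>

lemma braid_swap:
  assumes "a \<in> carrier G" "b \<in> carrier G" "c \<in> carrier G"
    and ab: "a \<otimes> b \<otimes> a = b \<otimes> a \<otimes> b" and bc: "b \<otimes> c \<otimes> b = c \<otimes> b \<otimes> c" and ac: "a \<otimes> c = c \<otimes> a"
  shows "(b \<otimes> a \<otimes> c \<otimes> b) \<otimes> a = c \<otimes> (b \<otimes> a \<otimes> c \<otimes> b)"
    and "(b \<otimes> a \<otimes> c \<otimes> b) \<otimes> c = a \<otimes> (b \<otimes> a \<otimes> c \<otimes> b)"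
proof -
  note cl = assms(1-3)
  have "(b \<otimes> a \<otimes> c \<otimes> b) \<otimes> a = b \<otimes> (c \<otimes> a) \<otimes> b \<otimes> a"
    unfolding ac[symmetric] using cl by (simp add: m_assoc)
  also have "\<dots> = b \<otimes> c \<otimes> (a \<otimes> b \<otimes> a)" using cl by (simp add: m_assoc)
  also have "\<dots> = (b \<otimes> c \<otimes> b) \<otimes> a \<otimes> b" unfolding ab using cl by (simp add: m_assoc)
  also have "\<dots> = c \<otimes> b \<otimes> (c \<otimes> a) \<otimes> b" unfolding bc using cl by (simp add: m_assoc)
  also have "\<dots> = c \<otimes> (b \<otimes> a \<otimes> c \<otimes> b)"
    unfolding ac[symmetric] using cl by (simp add: m_assoc)
  finally show "(b \<otimes> a \<otimes> c \<otimes> b) \<otimes> a = c \<otimes> (b \<otimes> a \<otimes> c \<otimes> b)" .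
  have "(b \<otimes> a \<otimes> c \<otimes> b) \<otimes> c = b \<otimes> a \<otimes> (c \<otimes> b \<otimes> c)" using cl by (simp add: m_assoc)
  also have "\<dots> = (b \<otimes> a \<otimes> b) \<otimes> c \<otimes> b" unfolding bc[symmetric] using cl by (simp add: m_assoc)
  also have "\<dots> = a \<otimes> (b \<otimes> a \<otimes> c \<otimes> b)" unfolding ab[symmetric] using cl by (simp add: m_assoc)
  finally show "(b \<otimes> a \<otimes> c \<otimes> b) \<otimes> c = a \<otimes> (b \<otimes> a \<otimes> c \<otimes> b)" .
qed

lemma commutes_generate:
  assumes "y \<in> generate G H" "H \<subseteq> carrier G" "z \<in> carrier G"
    and "\<And>x. x \<in> H \<Longrightarrow> z \<otimes> x = x \<otimes> z"
  shows "z \<otimes> y = y \<otimes> z"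
  using assms(1)
proof induction
  case (inv h)
  then show ?case using assms by (intro intertwine_inv) auto
next
  case (eng h1 h2)
  then show ?case using assms generate_in_carrier by (intro intertwine_mult) auto
qed (use assms in auto)

text \<open>Under commutation the braid relation reads x x y = x y y, and cancellation leaves x =
  y.\<close>

lemma eq_of_commute_of_braid:
  assumes "x \<in> carrier G" "y \<in> carrier G" "x \<otimes> y = y \<otimes> x" "x \<otimes> y \<otimes> x = y \<otimes> x \<otimes> y"
  shows "x = y"
  using assms by (metis l_cancel m_assoc m_closed)

end

section \<open>Totally symmetric sets\<close>

locale totally_symmetric = group G for G (structure) +
  fixes x :: "nat \<Rightarrow> 'a" and k :: nat
  assumes x_closed [simp]: "i < k \<Longrightarrow> x i \<in> carrier G"
    and x_commute: "i < k \<Longrightarrow> j < k \<Longrightarrow> x i \<otimes> x j = x j \<otimes> x i"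
    and x_inj: "inj_on x {..<k}"
    and x_permute: "p permutes {..<k} \<Longrightarrow> \<exists>g\<in>carrier G. \<forall>i<k. g \<otimes> x i = x (p i) \<otimes> g"
begin

text \<open>The factors come in increasing order of index, as the ambient group may be
  noncommutative; elements of \<open>I\<close> from \<open>m\<close> on are ignored.\<close>

fun subprod :: "nat \<Rightarrow> nat set \<Rightarrow> 'a" where
  "subprod 0 I = \<one>"
| "subprod (Suc m) I = subprod m I \<otimes> (if m \<in> I then x m else \<one>)"

lemma subprod_closed [simp]: "m \<le> k \<Longrightarrow> subprod m I \<in> carrier G"
  by (induction m) auto

lemma commutes_subprod:
  assumes "g \<in> carrier G" "m \<le> k" "\<And>i. i \<in> I \<Longrightarrow> i < m \<Longrightarrow> g \<otimes> x i = x i \<otimes> g"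
  shows "g \<otimes> subprod m I = subprod m I \<otimes> g"
  using assms(2,3)
proof (induction m)
  case (Suc m)
  then show ?case using assms(1) by (simp only: subprod.simps) (rule intertwine_mult, auto)
qed (use assms in auto)

lemma subprod_remove:
  assumes "i \<in> I" "i < m" "m \<le> k"
  shows "subprod m I = subprod m (I - {i}) \<otimes> x i"
  using assms(2,3)
proof (induction m)
  case (Suc m)
  show ?case
  proof (cases "i = m")
    case True
    \<comment> \<open>Factors of index below \<open>m\<close> do not notice the removal of
      \<open>m\<close>, so only the last factor changes.\<close>
    have "subprod l I = subprod l (I - {m})" if "l \<le> m" for l
      using that by (induction l) auto
    from this[of m] show ?thesis using True assms(1) Suc.prems by simp
  next
    case False
    then have "subprod m I = subprod m (I - {i}) \<otimes> x i" using Suc by auto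
    moreover have "x m \<otimes> x i = x i \<otimes> x m" using Suc x_commute by auto
    ultimately show ?thesis using False Suc by (auto simp: m_assoc)
  qed
qed auto

text \<open>A transposition moving one factor of a product to the unused index \<open>k - 1\<close> fixes every
  product that omits this factor.\<close>

lemma subprod_eq_imp_subset:
  assumes eq: "subprod (k - 1) I = subprod (k - 1) J" and I: "I \<subseteq> {..<k - 1}"
  shows "I \<subseteq> J"
proof (rule ccontr)
  let ?m = "k - 1"
  assume "\<not> I \<subseteq> J"
  then obtain i where i: "i \<in> I" "i \<notin> J" by auto
  then have ik: "i < ?m" "i < k" "?m < k" using I by auto
  have "transpose i ?m permutes {..<k}" using ik by (intro permutes_swap_id) auto
  then obtain g where g: "g \<in> carrier G" "\<And>j. j < k \<Longrightarrow> g \<otimes> x j = x (transpose i ?m j) \<otimes> g"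
    using x_permute by blast
  have fix_x: "g \<otimes> x j = x j \<otimes> g" if "j < ?m" "j \<noteq> i" for j
    using g(2)[of j] that by simp
  let ?P = "subprod ?m (I - {i})"
  have P: "subprod ?m I = ?P \<otimes> x i" using i ik by (intro subprod_remove) auto
  have "g \<otimes> ?P = ?P \<otimes> g" using g fix_x by (intro commutes_subprod) auto
  then have 1: "g \<otimes> (?P \<otimes> x i) = (?P \<otimes> x ?m) \<otimes> g"
    using g ik by (intro intertwine_mult) auto
  \<comment> \<open>\<open>J\<close> omits \<open>i\<close>, so \<open>g\<close> also commutes with
    this same product written over \<open>J\<close>. Compared with the previous relation, where
    \<open>x i\<close> turns into \<open>x ?m\<close>, this contradicts injectivity after
    cancellation.\<close>
  have "g \<otimes> subprod ?m J = subprod ?m J \<otimes> g"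
    using g(1) fix_x i by (intro commutes_subprod) (simp, simp, metis)
  then have "g \<otimes> (?P \<otimes> x i) = (?P \<otimes> x i) \<otimes> g"
    using eq P by simp
  then have "x i = x ?m" using 1 g ik by simp
  then show False using x_inj ik by (auto dest: inj_onD)
qed

text \<open>An element \<open>c p \<otimes> subprod (k - 1) I\<close> determines \<open>p\<close> by
  its conjugation action on the \<open>x i\<close>; once \<open>c p\<close> is cancelled, the
  remaining product determines \<open>I\<close>. So the pairs (p, I) inject into the group.\<close>

theorem card_ge:
  assumes "finite (carrier G)"
  shows "2 ^ (k - 1) * fact k \<le> card (carrier G)"
proof -
  define c where "c p = (SOME g. g \<in> carrier G \<and> (\<forall>i<k. g \<otimes> x i = x (p i) \<otimes> g))" for p
  have c: "c p \<in> carrier G \<and> (\<forall>i<k. c p \<otimes> x i = x (p i) \<otimes> c p)" if "p permutes {..<k}" for p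
    unfolding c_def by (rule someI_ex) (use x_permute[OF that] in blast)
  let ?A = "{p. p permutes {..<k}} \<times> Pow {..<k - 1}"
  let ?F = "\<lambda>(p, I). c p \<otimes> subprod (k - 1) I"
  \<comment> \<open>The product over \<open>I\<close> commutes with every \<open>x i\<close>, so it
    does not disturb the permutation induced by \<open>c p\<close>.\<close>
  have conj: "(c p \<otimes> subprod (k - 1) I) \<otimes> x i = x (p i) \<otimes> (c p \<otimes> subprod (k - 1) I)"
    if p: "p permutes {..<k}" and i: "i < k" for p I i
  proof -
    have "p i < k" using permutes_in_image[OF p, of i] i by auto
    moreover have "subprod (k - 1) I \<otimes> x i = x i \<otimes> subprod (k - 1) I"
      using commutes_subprod[of "x i" "k - 1" I] i x_commute by simp
    ultimately show ?thesis
      using c[OF p] i by (intro intertwine_comp[of _ _ "x i"]) simp_all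
  qed
  have inj: "inj_on ?F ?A"
  proof (rule inj_onI, clarify)
    fix p I q J
    assume p: "p permutes {..<k}" and q: "q permutes {..<k}"
      and I: "I \<subseteq> {..<k - 1}" and J: "J \<subseteq> {..<k - 1}"
      and eq: "c p \<otimes> subprod (k - 1) I = c q \<otimes> subprod (k - 1) J"
    have "p i = q i" for i
    proof (cases "i < k")
      case True
      then have pq: "p i < k" "q i < k"
        using permutes_in_image[OF p, of i] permutes_in_image[OF q, of i] by auto
      have "x (p i) \<otimes> (c p \<otimes> subprod (k - 1) I) = x (q i) \<otimes> (c p \<otimes> subprod (k - 1) I)"
        using conj[OF p True, of I] conj[OF q True, of J] eq by simp
      then have "x (p i) = x (q i)" using pq c[OF p] by simp
      then show ?thesis using x_inj pq by (auto dest: inj_onD)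
    next
      case False
      then show ?thesis using p q by (simp add: permutes_def)
    qed
    then have pq: "p = q" by auto
    then have "subprod (k - 1) I = subprod (k - 1) J"
      using eq c[OF p] by simp
    then show "p = q \<and> I = J"
      using pq subprod_eq_imp_subset I J by (metis subset_antisym)
  qed
  have "?F ` ?A \<subseteq> carrier G" using c by auto
  then have "card ?A \<le> card (carrier G)"
    using inj assms by (metis card_image card_mono)
  then show ?thesis
    by (simp add: card_cartesian_product card_permutations card_Pow mult.commute)
qed

end

section \<open>Groups generated by Artin generators\<close>

text \<open>Generation and the braid relations alone are required, so \<open>B\<close> may be any
  quotient of the braid group; the collapse argument below is applied to such a quotient.\<close>

locale artin_group = group B for B (structure) +
  fixes s :: "nat \<Rightarrow> 'a" and n :: nat
  assumes s_closed [simp]: "1 \<le> i \<Longrightarrow> i < n \<Longrightarrow> s i \<in> carrier B"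
    and far: "1 \<le> i \<Longrightarrow> i + 2 \<le> j \<Longrightarrow> j < n \<Longrightarrow> s i \<otimes> s j = s j \<otimes> s i"
    and adj: "1 \<le> i \<Longrightarrow> i + 1 < n \<Longrightarrow> s i \<otimes> s (i + 1) \<otimes> s i = s (i + 1) \<otimes> s i \<otimes> s (i + 1)"
    and gens: "carrier B = generate B (s ` {1..<n})"
begin

abbreviation "D \<equiv> derived B (carrier B)"

lemma D_subgroup: "subgroup D B"
  by (rule normal_imp_subgroup[OF derived_self_is_normal])

lemma D_closed: "d \<in> D \<Longrightarrow> d \<in> carrier B"
  by (rule subgroup.mem_carrier[OF D_subgroup])

lemma D_mult: "a \<in> D \<Longrightarrow> b \<in> D \<Longrightarrow> a \<otimes> b \<in> D"
  by (rule subgroup.m_closed[OF D_subgroup])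

lemma D_conj: "c \<in> carrier B \<Longrightarrow> d \<in> D \<Longrightarrow> c \<otimes> d \<otimes> inv c \<in> D"
  by (rule normal.inv_op_closed2[OF derived_self_is_normal])

lemma D_swap:
  assumes "c \<otimes> d \<in> D" "c \<in> carrier B" "d \<in> carrier B"
  shows "d \<otimes> c \<in> D"
proof -
  have "d \<otimes> (c \<otimes> d) \<otimes> inv d = d \<otimes> c"
    using assms(2,3) by (simp add: m_assoc)
  then show ?thesis using D_conj[OF assms(3,1)] by simp
qed

lemma s_commute:
  assumes "1 \<le> i" "1 \<le> j" "i < n" "j < n" "i + 2 \<le> j \<or> j + 2 \<le> i \<or> i = j"
  shows "s i \<otimes> s j = s j \<otimes> s i"
  using assms(5)
proof (elim disjE)
  assume "i + 2 \<le> j"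
  then show ?thesis by (rule far[OF assms(1) _ assms(4)])
next
  assume "j + 2 \<le> i"
  then show ?thesis by (rule far[OF assms(2) _ assms(3), symmetric])
qed (rule arg_cong2[where f = "(\<otimes>)"], auto)

text \<open>Neighbouring generators are conjugate: \<open>s i \<otimes> s (Suc i)\<close> conjugates
  \<open>s i\<close> to \<open>s (Suc i)\<close>. Hence their ratio is a commutator, and the ratios
  telescope down to \<open>s 1\<close>.\<close>

lemma s_ratio_in_D:
  assumes "1 \<le> i" "i < n"
  shows "s i \<otimes> inv (s 1) \<in> D"
  using assms
proof (induction rule: nat_induct_at_least)
  case base
  then show ?case using D_subgroup by (simp add: subgroup.one_closed)
next
  case (Suc i)
  have [simp]: "s i \<in> carrier B" "s (Suc i) \<in> carrier B" "s 1 \<in> carrier B" "s (Suc 0) \<in> carrier B"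
    using Suc by auto
  have "(s i \<otimes> s (Suc i)) \<otimes> s i \<otimes> inv (s i \<otimes> s (Suc i)) \<otimes> inv (s i) \<in> derived_set B (carrier B)"
    by (intro UN_I[of "s i \<otimes> s (Suc i)"] UN_I[of "s i"]) auto
  moreover have "(s i \<otimes> s (Suc i)) \<otimes> s i \<otimes> inv (s i \<otimes> s (Suc i)) = s (Suc i)"
    using adj[of i] Suc by (simp add: m_assoc inv_solve_right')
  ultimately have "s (Suc i) \<otimes> inv (s i) \<in> D"
    unfolding derived_def by (simp add: generate.incl)
  then have "(s (Suc i) \<otimes> inv (s i)) \<otimes> (s i \<otimes> inv (s 1)) \<in> D"
    by (rule D_mult) (use Suc in auto)
  then show ?case by (simp add: m_assoc inv_mult_cancel)
qed

text \<open>The abelianization of \<open>B\<close> is generated by the class of \<open>s 1\<close>.\<close>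

lemma shift_into_D:
  assumes "c \<in> carrier B" "1 < n"
  obtains e where "e \<in> generate B {s 1}" "c \<otimes> e \<in> D"
proof -
  have s1: "{s 1} \<subseteq> carrier B" "s 1 \<in> carrier B" using assms by auto
  have "c \<in> generate B (s ` {1..<n})" using assms gens by simp
  then have "\<exists>e\<in>generate B {s 1}. c \<otimes> e \<in> D"
  proof induction
    case one
    then show ?case using D_subgroup by (auto intro!: bexI[of _ \<one>] generate.one simp: subgroup.one_closed)
  next
    case (incl h)
    then show ?case using s_ratio_in_D by (auto intro!: bexI[of _ "inv (s 1)"] generate.inv)
  next
    case (inv h)
    then obtain i where i: "h = s i" "1 \<le> i" "i < n" by auto
    then have "inv (s i \<otimes> inv (s 1)) \<in> D"
      using s_ratio_in_D D_subgroup by (simp add: subgroup.m_inv_closed)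
    then have "s 1 \<otimes> inv (s i) \<in> D" using i s1 by (simp add: inv_mult_group)
    then have "inv (s i) \<otimes> s 1 \<in> D" using D_swap[of "s 1" "inv (s i)"] i s1 by simp
    then show ?case using i by (auto intro!: bexI[of _ "s 1"] generate.incl)
  next
    case (eng a b)
    then obtain e e' where e: "e \<in> generate B {s 1}" "e' \<in> generate B {s 1}" "a \<otimes> e \<in> D" "b \<otimes> e' \<in> D"
      by auto
    have ab: "a \<in> carrier B" "b \<in> carrier B" using eng gens by auto
    have ee: "e \<in> carrier B" "e' \<in> carrier B" using e s1 generate_in_carrier by blast+
    \<comment> \<open>The correction for \<open>a \<otimes> b\<close> is
      \<open>e' \<otimes> e\<close>, in this order: a b e' e is the conjugate of b e' by a, followed
      by a e.\<close>
    have "(a \<otimes> (b \<otimes> e') \<otimes> inv a) \<otimes> (a \<otimes> e) \<in> D"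
      by (rule D_mult) (use e ab D_conj in auto)
    also have "(a \<otimes> (b \<otimes> e') \<otimes> inv a) \<otimes> (a \<otimes> e) = (a \<otimes> b) \<otimes> (e' \<otimes> e)"
      using ab ee by (simp add: m_assoc inv_mult_cancel)
    finally show ?case using e by (auto intro!: generate.eng)
  qed
  then show thesis using that by blast
qed

text \<open>Starting from \<open>\<sigma>\<^sub>3 = \<sigma>\<^sub>5\<close>, which commutes with \<open>\<sigma>\<^sub>2\<close>, the collapse spreads to neighbouring
  generators: two that commute and satisfy the braid relation are equal.\<close>

lemma s_eq_Suc:
  assumes "1 \<le> i" "i + 1 < n" "s i \<otimes> s (i + 1) = s (i + 1) \<otimes> s i"
  shows "s (i + 1) = s i"
proof -
  have "s i \<in> carrier B" "s (i + 1) \<in> carrier B" using assms by auto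
  then show ?thesis
    using eq_of_commute_of_braid[OF _ _ assms(3) adj[OF assms(1,2)]] by metis
qed

lemma s_collapse:
  assumes n: "6 \<le> n" and eq: "s 3 = s 5" and i: "1 \<le> i" "i < n"
  shows "s i = s 3"
proof -
  have "s (2 + 1) = s 2"
    by (rule s_eq_Suc) (use s_commute[of 2 5] n in \<open>simp_all add: eq\<close>)
  then have s2: "s 2 = s 3" by simp
  \<comment> \<open>The induction carries two consecutive equalities because
    \<open>s (i + 2)\<close> commutes with \<open>s i\<close>, which by then equals its neighbour
    \<open>s (i + 1)\<close>.\<close>
  have up: "s i = s 3 \<and> s (i + 1) = s 3" if "2 \<le> i" "i + 1 < n" for i
    using that
  proof (induction rule: nat_induct_at_least)
    case base
    then show ?case using s2 by simp
  next
    case (Suc i)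
    then have e: "s i = s 3" "s (i + 1) = s 3" by simp_all
    have comm: "s i \<otimes> s (i + 2) = s (i + 2) \<otimes> s i" using s_commute[of i "i + 2"] Suc by simp
    have "s (i + 1 + 1) = s (i + 1)"
      by (rule s_eq_Suc) (use comm e Suc in simp_all)
    then show ?case using e by simp
  qed
  \<comment> \<open>The remaining index 1 is reached downwards: \<open>s 1\<close> commutes with
    \<open>s 3\<close>, which equals its neighbour \<open>s 2\<close>.\<close>
  have comm: "s 1 \<otimes> s 3 = s 3 \<otimes> s 1" using s_commute[of 1 3] n by simp
  have "s (1 + 1) = s 1"
    by (rule s_eq_Suc) (use n s2 comm in \<open>simp_all flip: numeral_2_eq_2\<close>)
  then have s1: "s 1 = s 3" using s2 by (simp flip: numeral_2_eq_2)
  consider "i = 1" | "i = 2" | "2 \<le> i - 1" "i - 1 + 1 = i"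
    using i by linarith
  then show ?thesis
  proof cases
    case 3
    then show ?thesis using up[of "i - 1"] i by simp
  qed (use s1 s2 in simp_all)
qed

section \<open>Abelian quotients\<close>

lemma comm_group_of_collapse:
  assumes n: "6 \<le> n" and eq: "s 3 = s 5"
  shows "comm_group B"
proof (rule group_comm_groupI)
  have "s ` {1..<n} \<subseteq> {s 3}" using s_collapse[OF n eq] by auto
  then have gen: "a \<in> generate B {s 3}" if "a \<in> carrier B" for a
    using that gens mono_generate by blast
  have s3: "s 3 \<in> carrier B" using n by simp
  have s3_comm: "s 3 \<otimes> a = a \<otimes> s 3" if "a \<in> carrier B" for a
    by (rule commutes_generate[OF gen[OF that]]) (use s3 in auto)
  show "a \<otimes> b = b \<otimes> a" if "a \<in> carrier B" "b \<in> carrier B" for a b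
    by (rule commutes_generate[OF gen[OF that(2)]]) (use s3 that s3_comm in auto)
qed

text \<open>Relations and generation survive in a quotient, so the collapse can be carried out
  modulo a normal subgroup.\<close>

lemma artin_group_Mod:
  assumes N: "N \<lhd> B"
  shows "artin_group (B Mod N) (\<lambda>i. N #> s i) n"
proof -
  interpret N: normal N B by fact
  interpret h: group_hom B "B Mod N" "\<lambda>a. N #> a"
    using N.r_coset_hom_Mod N.factorgroup_is_group is_group
    by (simp add: group_hom_def group_hom_axioms_def)
  show ?thesis
  proof (intro artin_group.intro artin_group_axioms.intro)
    show "group (B Mod N)" by (rule N.factorgroup_is_group)
    show "N #> s i \<in> carrier (B Mod N)" if "1 \<le> i" "i < n" for i
      using that by simp
    show "(N #> s i) \<otimes>\<^bsub>B Mod N\<^esub> (N #> s j) = (N #> s j) \<otimes>\<^bsub>B Mod N\<^esub> (N #> s i)"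
      if "1 \<le> i" "i + 2 \<le> j" "j < n" for i j
    proof -
      have "s i \<in> carrier B" "s j \<in> carrier B" using that by auto
      then show ?thesis using far[OF that] by (metis h.hom_mult)
    qed
    show "(N #> s i) \<otimes>\<^bsub>B Mod N\<^esub> (N #> s (i + 1)) \<otimes>\<^bsub>B Mod N\<^esub> (N #> s i)
        = (N #> s (i + 1)) \<otimes>\<^bsub>B Mod N\<^esub> (N #> s i) \<otimes>\<^bsub>B Mod N\<^esub> (N #> s (i + 1))"
      if "1 \<le> i" "i + 1 < n" for i
    proof -
      have "s i \<in> carrier B" "s (i + 1) \<in> carrier B" using that by auto
      then show ?thesis using adj[OF that] by (metis h.hom_mult m_closed)
    qed
    have "carrier (B Mod N) = (\<lambda>a. N #> a) ` carrier B"
      by (auto simp: FactGroup_def RCOSETS_def)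
    also have "\<dots> = generate (B Mod N) ((\<lambda>a. N #> a) ` s ` {1..<n})"
      unfolding gens by (rule h.generate_img[symmetric]) auto
    finally show "carrier (B Mod N) = generate (B Mod N) ((\<lambda>i. N #> s i) ` {1..<n})"
      by (simp only: image_image)
  qed
qed

text \<open>Modulo \<open>N\<close> the generators \<open>s 3\<close> and \<open>s 5\<close> agree,
  so the quotient collapses to an abelian group and \<open>N\<close> contains all
  commutators.\<close>

lemma derived_subset_of_ratio:
  assumes N: "N \<lhd> B" and n: "6 \<le> n" and z: "s 3 \<otimes> inv (s 5) \<in> N"
  shows "D \<subseteq> N"
proof (rule derived_minimal[OF N])
  interpret N: normal N B by fact
  have "s 3 \<in> N #> s 5"
    using z n N.rcos_module[OF is_group, of "s 5" "s 3"] by simp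
  then have "N #> s 3 = N #> s 5"
    using n N.is_subgroup repr_independence[of "s 3" N "s 5"] by simp
  then show "comm_group (B Mod N)"
    by (rule artin_group.comm_group_of_collapse[OF artin_group_Mod[OF N] n])
qed

section \<open>Permuting the odd generators by conjugation\<close>

text \<open>Index \<open>i\<close> stands for the generator \<open>s (2 * i + 3)\<close>.
  Commutation with \<open>s 1\<close> makes the same element permute the ratios of these generators
  to \<open>s 1\<close>.\<close>

definition realized :: "nat \<Rightarrow> (nat \<Rightarrow> nat) \<Rightarrow> bool" where
  "realized k p \<longleftrightarrow> (\<exists>c\<in>carrier B. c \<otimes> s 1 = s 1 \<otimes> c \<and> (\<forall>i<k. c \<otimes> s (2 * i + 3) = s (2 * p i + 3) \<otimes> c))"

text \<open>The bound \<open>2 * k + 1 < n\<close> ensures that the last odd generator, with index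
  \<open>2 * (k - 1) + 3\<close>, exists.\<close>

lemma realized_comp:
  assumes n: "2 * k + 1 < n" and p: "realized k p" "p permutes {..<k}"
    and q: "realized k q" "q permutes {..<k}"
  shows "realized k (q \<circ> p)"
proof -
  obtain c where c: "c \<in> carrier B" "c \<otimes> s 1 = s 1 \<otimes> c"
      "\<And>i. i < k \<Longrightarrow> c \<otimes> s (2 * i + 3) = s (2 * p i + 3) \<otimes> c"
    using p unfolding realized_def by blast
  obtain d where d: "d \<in> carrier B" "d \<otimes> s 1 = s 1 \<otimes> d"
      "\<And>i. i < k \<Longrightarrow> d \<otimes> s (2 * i + 3) = s (2 * q i + 3) \<otimes> d"
    using q unfolding realized_def by blast
  have s1: "s 1 \<in> carrier B" using n by simp
  have "(d \<otimes> c) \<otimes> s (2 * i + 3) = s (2 * q (p i) + 3) \<otimes> (d \<otimes> c)" if i: "i < k" for i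
  proof -
    have "p i < k" using permutes_in_image[OF p(2), of i] i by simp
    moreover from this have "q (p i) < k" using permutes_in_image[OF q(2), of "p i"] by simp
    ultimately show ?thesis
      by (intro intertwine_comp[OF c(3) d(3)] c(1) d(1) s_closed i) (use i n in linarith)+
  qed
  moreover have "(d \<otimes> c) \<otimes> s 1 = s 1 \<otimes> (d \<otimes> c)"
    by (rule intertwine_comp[OF c(2) d(2) c(1) d(1) s1 s1 s1])
  ultimately show ?thesis
    unfolding realized_def comp_def using c(1) d(1) by blast
qed

lemma realized_adjacent:
  assumes n: "2 * k + 1 < n" and a: "a + 1 < k"
  shows "realized k (transpose a (a + 1))"
proof -
  define j where "j = 2 * a + 3"
  define g where "g = s (j + 1) \<otimes> s j \<otimes> s (j + 2) \<otimes> s (j + 1)"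
  have j: "1 \<le> j" "j + 2 < n" using a n by (auto simp: j_def)
  then have cl: "s j \<in> carrier B" "s (j + 1) \<in> carrier B" "s (j + 2) \<in> carrier B" by simp_all
  then have g: "g \<in> carrier B" by (simp add: g_def)
  have b1: "s j \<otimes> s (j + 1) \<otimes> s j = s (j + 1) \<otimes> s j \<otimes> s (j + 1)"
    by (rule adj) (use j in auto)
  have b2: "s (j + 1) \<otimes> s (j + 2) \<otimes> s (j + 1) = s (j + 2) \<otimes> s (j + 1) \<otimes> s (j + 2)"
    using adj[of "j + 1"] j by (simp add: numeral_2_eq_2)
  have b3: "s j \<otimes> s (j + 2) = s (j + 2) \<otimes> s j" by (rule s_commute) (use j in auto)
  note swap = braid_swap[OF cl b1 b2 b3, folded g_def]
  \<comment> \<open>The letters of \<open>g\<close> have indices \<open>j\<close> to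
    \<open>j + 2\<close>, and the condition keeps \<open>m\<close> at distance at least 2 from all
    of them. Every odd index other than \<open>j\<close> and \<open>j + 2\<close> satisfies it,
    including 1 since \<open>j\<close> is at least 3.\<close>
  have comm: "g \<otimes> s m = s m \<otimes> g" if m: "1 \<le> m" "m < n" "m + 2 \<le> j \<or> j + 4 \<le> m" for m
  proof -
    have sm: "s m \<in> carrier B" using m by simp
    have "s m \<otimes> s j = s j \<otimes> s m" "s m \<otimes> s (j + 1) = s (j + 1) \<otimes> s m"
      "s m \<otimes> s (j + 2) = s (j + 2) \<otimes> s m"
      by (rule s_commute; use m j in linarith)+
    then have "s m \<otimes> g = g \<otimes> s m"
      unfolding g_def by (intro intertwine_mult sm cl m_closed)
    from this[symmetric] show ?thesis .
  qed
  have "g \<otimes> s (2 * i + 3) = s (2 * transpose a (a + 1) i + 3) \<otimes> g" if i: "i < k" for i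
  proof -
    consider "i = a" | "i = a + 1" | "i < a" | "a + 1 < i" by linarith
    then show ?thesis
    proof cases
      case 1
      have "2 * (a + 1) + 3 = j + 2" by (simp add: j_def)
      then show ?thesis using 1 swap(1) by (simp add: j_def)
    next
      case 2
      have "2 * (a + 1) + 3 = j + 2" by (simp add: j_def)
      then show ?thesis using 2 swap(2) by (simp add: j_def)
    next
      case 3
      have "g \<otimes> s (2 * i + 3) = s (2 * i + 3) \<otimes> g"
        by (rule comm) (use 3 i n in \<open>auto simp: j_def\<close>)
      then show ?thesis using 3 by simp
    next
      case 4
      have "g \<otimes> s (2 * i + 3) = s (2 * i + 3) \<otimes> g"
        by (rule comm) (use 4 i n in \<open>auto simp: j_def\<close>)
      then show ?thesis using 4 by simp
    qed
  qed
  moreover have "g \<otimes> s 1 = s 1 \<otimes> g" by (rule comm) (use n in \<open>auto simp: j_def\<close>)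
  ultimately show ?thesis unfolding realized_def using g by blast
qed

text \<open>Adjacent transpositions suffice: conjugating (a b) by (b b+1) gives (a b+1).\<close>

lemma realized_transpose_less:
  assumes n: "2 * k + 1 < n" and "a < b" "b < k"
  shows "realized k (transpose a b)"
proof -
  have "Suc a \<le> b" using assms by simp
  then show ?thesis using \<open>b < k\<close>
  proof (induction rule: nat_induct_at_least)
    case base
    then show ?case using realized_adjacent[OF n, of a] by simp
  next
    case (Suc b)
    have eq: "transpose b (b + 1) \<circ> (transpose a b \<circ> transpose b (b + 1)) = transpose a (Suc b)"
      using Suc.hyps by (auto simp: fun_eq_iff transpose_def)
    have perm: "transpose b (b + 1) permutes {..<k}" "transpose a b permutes {..<k}"
      using Suc by (auto intro!: permutes_swap_id)
    have r: "realized k (transpose b (b + 1))" using realized_adjacent[OF n, of b] Suc by simp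
    have r': "realized k (transpose a b)" using Suc by simp
    have "realized k (transpose b (b + 1) \<circ> (transpose a b \<circ> transpose b (b + 1)))"
      by (intro realized_comp[OF n] permutes_compose r r' perm)
    then show ?case unfolding eq .
  qed
qed

lemma realized_permutation:
  assumes n: "2 * k + 1 < n" and p: "p permutes {..<k}"
  shows "realized k p"
  using p finite_lessThan
proof (induction rule: permutes_induct)
  case id
  have "s (2 * i + 3) \<in> carrier B" if "i < k" for i using that n by simp
  then show ?case unfolding realized_def using n by (intro bexI[of _ \<one>]) auto
next
  case (swap a b p)
  then have "realized k (transpose a b)"
    using realized_transpose_less[OF n, of a b] realized_transpose_less[OF n, of b a]
    by (metis lessThan_iff linorder_neq_iff transpose_commute)
  then show ?case
    using swap by (intro realized_comp[OF n] permutes_swap_id)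
qed

text \<open>A realizing element is moved into \<open>D\<close> by a factor \<open>e\<close> from the
  subgroup generated by \<open>s 1\<close>. This factor commutes with \<open>s 1\<close> and with
  the odd generators, so the induced permutation stays the same.\<close>

lemma realized_in_D:
  assumes n: "2 * k + 1 < n" and "realized k p" and p: "p permutes {..<k}"
  obtains d where "d \<in> D"
    "\<And>i. i < k \<Longrightarrow> d \<otimes> (s (2 * i + 3) \<otimes> inv (s 1)) = (s (2 * p i + 3) \<otimes> inv (s 1)) \<otimes> d"
proof -
  obtain c where c: "c \<in> carrier B" "c \<otimes> s 1 = s 1 \<otimes> c"
      "\<And>i. i < k \<Longrightarrow> c \<otimes> s (2 * i + 3) = s (2 * p i + 3) \<otimes> c"
    using assms(2) unfolding realized_def by blast
  obtain e where e: "e \<in> generate B {s 1}" "c \<otimes> e \<in> D"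
    using shift_into_D[OF c(1)] n by auto
  have s1: "s 1 \<in> carrier B" using n by simp
  then have ec: "e \<in> carrier B" using e generate_in_carrier by blast
  \<comment> \<open>The only index left out is 2, the neighbour of 1.\<close>
  have es: "e \<otimes> s m = s m \<otimes> e" if "1 \<le> m" "m < n" "m = 1 \<or> 3 \<le> m" for m
  proof (rule commutes_generate[OF e(1), symmetric])
    show "s m \<otimes> y = y \<otimes> s m" if "y \<in> {s 1}" for y
    proof -
      have "s m \<otimes> s 1 = s 1 \<otimes> s m" by (rule s_commute) (use \<open>m < n\<close> \<open>m = 1 \<or> 3 \<le> m\<close> in auto)
      then show ?thesis using that by simp
    qed
  qed (use s1 that in auto)
  have "(c \<otimes> e) \<otimes> s 1 = s 1 \<otimes> (c \<otimes> e)"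
    by (rule intertwine_comp[OF es c(2)]) (use n c ec in auto)
  then have 1: "(c \<otimes> e) \<otimes> inv (s 1) = inv (s 1) \<otimes> (c \<otimes> e)"
    by (rule intertwine_inv) (use c ec s1 in auto)
  show thesis
  proof (rule that[OF e(2)])
    fix i assume i: "i < k"
    have pi: "p i < k" using permutes_in_image[OF p, of i] i by simp
    have cl: "s (2 * i + 3) \<in> carrier B" "s (2 * p i + 3) \<in> carrier B" using i pi n by auto
    have "e \<otimes> s (2 * i + 3) = s (2 * i + 3) \<otimes> e" by (rule es) (use i n in auto)
    then have "(c \<otimes> e) \<otimes> s (2 * i + 3) = s (2 * p i + 3) \<otimes> (c \<otimes> e)"
      by (rule intertwine_comp[OF _ c(3)[OF i]]) (use cl c ec in auto)
    then show "(c \<otimes> e) \<otimes> (s (2 * i + 3) \<otimes> inv (s 1)) = (s (2 * p i + 3) \<otimes> inv (s 1)) \<otimes> (c \<otimes> e)"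
      by (rule intertwine_mult[OF _ 1]) (use cl c ec s1 in auto)
  qed
qed

section \<open>The lower bound for a nontrivial homomorphism on the commutator subgroup\<close>

theorem card_ge_of_nontrivial_hom:
  fixes G (structure)
  assumes n: "5 \<le> n" and G: "group G" "finite (carrier G)"
    and f: "f \<in> hom (B\<lparr>carrier := D\<rparr>) G" and nontriv: "\<exists>d\<in>D. f d \<noteq> \<one>\<^bsub>G\<^esub>"
  shows "2 ^ (n div 2 - 2) * fact (n div 2 - 1) \<le> card (carrier G)"
proof (cases "n = 5")
  case True
  \<comment> \<open>For \<open>n = 5\<close> there is no \<open>s 5\<close>, but the bound is only
    1.\<close>
  have "carrier G \<noteq> {}" using G(1) group.is_monoid monoid.one_closed by blast
  then have "0 < card (carrier G)" using G(2) by (simp add: card_gt_0_iff)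
  then show ?thesis using True by simp
next
  case False
  then have n6: "6 \<le> n" using n by simp
  \<comment> \<open>The odd indices 3, 5, ..., 2 k + 1 all lie below \<open>n\<close>, and
    \<open>2 \<le> k\<close> makes both \<open>x 0\<close> and \<open>x 1\<close> available.\<close>
  define k where "k = n div 2 - 1"
  have k: "2 * k + 1 < n" "2 \<le> k" unfolding k_def using n6 by linarith+
  interpret G: group G by fact
  interpret f: group_hom "B\<lparr>carrier := D\<rparr>" G f
    using f G(1) subgroup_imp_group[OF D_subgroup] by (simp add: group_hom_def group_hom_axioms_def)
  have f_closed: "f d \<in> carrier G" if "d \<in> D" for d
    using f.hom_closed that by simp
  have f_mult: "f (d \<otimes>\<^bsub>B\<^esub> d') = f d \<otimes>\<^bsub>G\<^esub> f d'" if "d \<in> D" "d' \<in> D" for d d'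
    using f.hom_mult that by simp
  have f_one: "f \<one>\<^bsub>B\<^esub> = \<one>\<^bsub>G\<^esub>" using f.hom_one by simp
  have f_inv: "f (inv\<^bsub>B\<^esub> d) = inv\<^bsub>G\<^esub> (f d)" if "d \<in> D" for d
    using f.hom_inv[of d] m_inv_consistent[OF D_subgroup that] that by simp
  define y where "y i = s (2 * i + 3) \<otimes>\<^bsub>B\<^esub> inv\<^bsub>B\<^esub> (s 1)" for i
  define x where "x i = f (y i)" for i
  have yD: "y i \<in> D" if "i < k" for i
    unfolding y_def by (rule s_ratio_in_D) (use that k in auto)
  have s1: "s 1 \<in> carrier B" using n by simp
  have y_comm: "y i \<otimes>\<^bsub>B\<^esub> y j = y j \<otimes>\<^bsub>B\<^esub> y i" if "i < k" "j < k" for i j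
  proof -
    have cl: "s (2 * i + 3) \<in> carrier B" "s (2 * j + 3) \<in> carrier B" using that k by auto
    have c: "s (2 * i + 3) \<otimes>\<^bsub>B\<^esub> s 1 = s 1 \<otimes>\<^bsub>B\<^esub> s (2 * i + 3)"
        "s (2 * i + 3) \<otimes>\<^bsub>B\<^esub> s (2 * j + 3) = s (2 * j + 3) \<otimes>\<^bsub>B\<^esub> s (2 * i + 3)"
        "s 1 \<otimes>\<^bsub>B\<^esub> s (2 * j + 3) = s (2 * j + 3) \<otimes>\<^bsub>B\<^esub> s 1"
      by (rule s_commute; use that k in presburger)+
    have yc: "y j \<in> carrier B" unfolding y_def using cl s1 by simp
    have 1: "s (2 * i + 3) \<otimes>\<^bsub>B\<^esub> y j = y j \<otimes>\<^bsub>B\<^esub> s (2 * i + 3)"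
      unfolding y_def by (intro intertwine_mult intertwine_inv c cl s1 inv_closed)
    have 2: "s 1 \<otimes>\<^bsub>B\<^esub> y j = y j \<otimes>\<^bsub>B\<^esub> s 1"
      unfolding y_def by (intro intertwine_mult intertwine_inv c cl s1 inv_closed HOL.refl)
    have "y j \<otimes>\<^bsub>B\<^esub> y i = y i \<otimes>\<^bsub>B\<^esub> y j"
      unfolding y_def[of i]
      by (intro intertwine_mult intertwine_inv 1[symmetric] 2[symmetric] cl s1 yc inv_closed)
    from this[symmetric] show ?thesis .
  qed
  have x_permute: "\<exists>g\<in>carrier G. \<forall>i<k. g \<otimes>\<^bsub>G\<^esub> x i = x (p i) \<otimes>\<^bsub>G\<^esub> g"
    if p: "p permutes {..<k}" for p
  proof -
    obtain d where d: "d \<in> D" "\<And>i. i < k \<Longrightarrow> d \<otimes>\<^bsub>B\<^esub> y i = y (p i) \<otimes>\<^bsub>B\<^esub> d"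
      using realized_in_D[OF k(1) realized_permutation[OF k(1) p] p] unfolding y_def by blast
    have "f d \<otimes>\<^bsub>G\<^esub> x i = x (p i) \<otimes>\<^bsub>G\<^esub> f d" if i: "i < k" for i
    proof -
      have "p i < k" using permutes_in_image[OF p, of i] i by simp
      then show ?thesis
        unfolding x_def using d(2)[OF i] f_mult[OF d(1) yD[OF i]] f_mult[OF yD d(1)] by metis
    qed
    then show ?thesis using f_closed[OF d(1)] by blast
  qed
  have x_closed: "x i \<in> carrier G" if "i < k" for i
    unfolding x_def by (rule f_closed[OF yD[OF that]])
  \<comment> \<open>Equality would put the ratio of \<open>s 3\<close> and \<open>s 5\<close> into a
    normal subgroup of \<open>B\<close> on which \<open>f\<close> is trivial; that subgroup then
    contains all of \<open>D\<close>, against nontriviality.\<close>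
  have x01: "x 0 \<noteq> x 1"
  proof
    assume eq: "x 0 = x 1"
    define z where "z = s 3 \<otimes>\<^bsub>B\<^esub> inv\<^bsub>B\<^esub> (s 5)"
    have cl: "s 3 \<in> carrier B" "s 5 \<in> carrier B" using n6 by simp_all
    have yD01: "y 0 \<in> D" "y 1 \<in> D" using yD k by simp_all
    have zy: "z = y 0 \<otimes>\<^bsub>B\<^esub> inv\<^bsub>B\<^esub> (y 1)"
      using cl s1 by (simp add: z_def y_def inv_mult_group m_assoc inv_mult_cancel)
    have iy: "inv\<^bsub>B\<^esub> (y 1) \<in> D" by (rule subgroup.m_inv_closed[OF D_subgroup yD01(2)])
    have zD: "z \<in> D" unfolding zy by (rule D_mult[OF yD01(1) iy])
    have fz: "f z = \<one>\<^bsub>G\<^esub>"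
      unfolding zy f_mult[OF yD01(1) iy] f_inv[OF yD01(2)]
      using eq x_closed[of 1] k by (simp add: x_def)
    \<comment> \<open>The kernel of \<open>f\<close> is normal only in \<open>D\<close>; this is its largest part that is normal in \<open>B\<close>.\<close>
    define N where "N = {d \<in> D. \<forall>c\<in>carrier B. f (c \<otimes>\<^bsub>B\<^esub> d \<otimes>\<^bsub>B\<^esub> inv\<^bsub>B\<^esub> c) = \<one>\<^bsub>G\<^esub>}"
    have "N \<lhd> B"
      unfolding normal_inv_iff
    proof (intro conjI ballI subgroupI)
      show "N \<subseteq> carrier B" using D_closed by (auto simp: N_def)
      show "N \<noteq> {}"
        using subgroup.one_closed[OF D_subgroup] f_one by (auto simp: N_def intro!: exI[of _ "\<one>\<^bsub>B\<^esub>"])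
    next
      fix d assume d: "d \<in> N"
      then have dD: "d \<in> D" by (simp add: N_def)
      have "f (c \<otimes>\<^bsub>B\<^esub> inv\<^bsub>B\<^esub> d \<otimes>\<^bsub>B\<^esub> inv\<^bsub>B\<^esub> c) = \<one>\<^bsub>G\<^esub>" if c: "c \<in> carrier B" for c
      proof -
        have "c \<otimes>\<^bsub>B\<^esub> inv\<^bsub>B\<^esub> d \<otimes>\<^bsub>B\<^esub> inv\<^bsub>B\<^esub> c = inv\<^bsub>B\<^esub> (c \<otimes>\<^bsub>B\<^esub> d \<otimes>\<^bsub>B\<^esub> inv\<^bsub>B\<^esub> c)"
          using c D_closed[OF dD] by (simp add: inv_mult_group m_assoc)
        then show ?thesis
          using f_inv[OF D_conj[OF c dD]] d c by (simp add: N_def)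
      qed
      then show "inv\<^bsub>B\<^esub> d \<in> N"
        using subgroup.m_inv_closed[OF D_subgroup dD] by (simp add: N_def)
    next
      fix d d' assume d: "d \<in> N" "d' \<in> N"
      then have dD: "d \<in> D" "d' \<in> D" by (simp_all add: N_def)
      have "f (c \<otimes>\<^bsub>B\<^esub> (d \<otimes>\<^bsub>B\<^esub> d') \<otimes>\<^bsub>B\<^esub> inv\<^bsub>B\<^esub> c) = \<one>\<^bsub>G\<^esub>" if c: "c \<in> carrier B" for c
      proof -
        have "c \<otimes>\<^bsub>B\<^esub> (d \<otimes>\<^bsub>B\<^esub> d') \<otimes>\<^bsub>B\<^esub> inv\<^bsub>B\<^esub> c
            = (c \<otimes>\<^bsub>B\<^esub> d \<otimes>\<^bsub>B\<^esub> inv\<^bsub>B\<^esub> c) \<otimes>\<^bsub>B\<^esub> (c \<otimes>\<^bsub>B\<^esub> d' \<otimes>\<^bsub>B\<^esub> inv\<^bsub>B\<^esub> c)"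
          using c D_closed[OF dD(1)] D_closed[OF dD(2)] by (simp add: m_assoc inv_mult_cancel)
        then show ?thesis
          using f_mult[OF D_conj[OF c dD(1)] D_conj[OF c dD(2)]] d c by (simp add: N_def)
      qed
      then show "d \<otimes>\<^bsub>B\<^esub> d' \<in> N" using D_mult[OF dD] by (simp add: N_def)
    next
      fix b d assume b: "b \<in> carrier B" and d: "d \<in> N"
      then have dD: "d \<in> D" by (simp add: N_def)
      have "f (c \<otimes>\<^bsub>B\<^esub> (b \<otimes>\<^bsub>B\<^esub> d \<otimes>\<^bsub>B\<^esub> inv\<^bsub>B\<^esub> b) \<otimes>\<^bsub>B\<^esub> inv\<^bsub>B\<^esub> c) = \<one>\<^bsub>G\<^esub>" if c: "c \<in> carrier B" for c
      proof -
        have "c \<otimes>\<^bsub>B\<^esub> (b \<otimes>\<^bsub>B\<^esub> d \<otimes>\<^bsub>B\<^esub> inv\<^bsub>B\<^esub> b) \<otimes>\<^bsub>B\<^esub> inv\<^bsub>B\<^esub> c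
            = (c \<otimes>\<^bsub>B\<^esub> b) \<otimes>\<^bsub>B\<^esub> d \<otimes>\<^bsub>B\<^esub> inv\<^bsub>B\<^esub> (c \<otimes>\<^bsub>B\<^esub> b)"
          using b c D_closed[OF dD] by (simp add: inv_mult_group m_assoc)
        then show ?thesis using d b c by (simp add: N_def)
      qed
      then show "b \<otimes>\<^bsub>B\<^esub> d \<otimes>\<^bsub>B\<^esub> inv\<^bsub>B\<^esub> b \<in> N" using D_conj[OF b dD] by (simp add: N_def)
    qed
    moreover have "z \<in> N"
    proof -
      \<comment> \<open>Since \<open>z\<close> commutes with \<open>s 1\<close>, conjugating it by
        \<open>c\<close> is the same as conjugating by \<open>c e\<close>, which lies in
        \<open>D\<close>, where \<open>f\<close> is multiplicative.\<close>
      have "f (c \<otimes>\<^bsub>B\<^esub> z \<otimes>\<^bsub>B\<^esub> inv\<^bsub>B\<^esub> c) = \<one>\<^bsub>G\<^esub>" if c: "c \<in> carrier B" for c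
      proof -
        obtain e where e: "e \<in> generate B {s 1}" "c \<otimes>\<^bsub>B\<^esub> e \<in> D"
          using shift_into_D[OF c] n by auto
        have ec: "e \<in> carrier B" using e(1) s1 generate_in_carrier by blast
        have zc: "z \<in> carrier B" by (rule D_closed[OF zD])
        have sc: "s 3 \<otimes>\<^bsub>B\<^esub> s 1 = s 1 \<otimes>\<^bsub>B\<^esub> s 3" "s 5 \<otimes>\<^bsub>B\<^esub> s 1 = s 1 \<otimes>\<^bsub>B\<^esub> s 5"
          by (rule s_commute; use n6 in simp)+
        have "s 1 \<otimes>\<^bsub>B\<^esub> z = z \<otimes>\<^bsub>B\<^esub> s 1"
          unfolding z_def by (intro intertwine_mult intertwine_inv sc[symmetric] cl s1 inv_closed)
        then have "z \<otimes>\<^bsub>B\<^esub> e = e \<otimes>\<^bsub>B\<^esub> z"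
          by (intro commutes_generate[OF e(1)]) (use s1 zc in auto)
        then have "(c \<otimes>\<^bsub>B\<^esub> e) \<otimes>\<^bsub>B\<^esub> z = (c \<otimes>\<^bsub>B\<^esub> z \<otimes>\<^bsub>B\<^esub> inv\<^bsub>B\<^esub> c) \<otimes>\<^bsub>B\<^esub> (c \<otimes>\<^bsub>B\<^esub> e)"
          using c ec zc by (simp add: m_assoc inv_mult_cancel)
        then have "f (c \<otimes>\<^bsub>B\<^esub> e) \<otimes>\<^bsub>G\<^esub> f z = f (c \<otimes>\<^bsub>B\<^esub> z \<otimes>\<^bsub>B\<^esub> inv\<^bsub>B\<^esub> c) \<otimes>\<^bsub>G\<^esub> f (c \<otimes>\<^bsub>B\<^esub> e)"
          using f_mult[OF e(2) zD] f_mult[OF D_conj[OF c zD] e(2)] by simp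
        then show ?thesis
          using fz f_closed[OF e(2)] f_closed[OF D_conj[OF c zD]] by simp
      qed
      then show ?thesis using zD by (simp add: N_def)
    qed
    ultimately have DN: "D \<subseteq> N"
      using derived_subset_of_ratio[OF _ n6] unfolding z_def by blast
    obtain d where d: "d \<in> D" "f d \<noteq> \<one>\<^bsub>G\<^esub>" using nontriv by blast
    then have "d \<in> N" using DN by blast
    then have "f (\<one>\<^bsub>B\<^esub> \<otimes>\<^bsub>B\<^esub> d \<otimes>\<^bsub>B\<^esub> inv\<^bsub>B\<^esub> \<one>\<^bsub>B\<^esub>) = \<one>\<^bsub>G\<^esub>"
      unfolding N_def using one_closed by blast
    then show False using d D_closed[OF d(1)] by simp
  qed
  have x_neq: "x i \<noteq> x j" if ij: "i < k" "j < k" "i \<noteq> j" for i j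
  proof
    assume eq: "x i = x j"
    \<comment> \<open>The first transposition takes \<open>i\<close> to 0 and \<open>j\<close> to a
      nonzero index; the second takes that index to 1 and fixes 0. A coincidence of any two images
      is thus carried to \<open>x 0 = x 1\<close>.\<close>
    define p where "p = transpose 1 (transpose 0 i j) \<circ> transpose 0 i"
    have "transpose 0 i j < k" using ij k by (simp add: transpose_def)
    then have p: "p permutes {..<k}"
      unfolding p_def using ij k by (intro permutes_compose permutes_swap_id) auto
    have pv: "p i = 0" "p j = 1" using ij by (auto simp: p_def transpose_def)
    obtain g where g: "g \<in> carrier G" "\<And>l. l < k \<Longrightarrow> g \<otimes>\<^bsub>G\<^esub> x l = x (p l) \<otimes>\<^bsub>G\<^esub> g"
      using x_permute[OF p] by blast
    have "x 0 \<otimes>\<^bsub>G\<^esub> g = x 1 \<otimes>\<^bsub>G\<^esub> g"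
      using g(2)[OF ij(1)] g(2)[OF ij(2)] unfolding pv eq by metis
    then show False using x01 x_closed[of 0] x_closed[of 1] g(1) k by simp
  qed
  have "totally_symmetric G x k"
  proof (intro totally_symmetric.intro totally_symmetric_axioms.intro G(1) x_closed x_permute)
    show "x i \<otimes>\<^bsub>G\<^esub> x j = x j \<otimes>\<^bsub>G\<^esub> x i" if "i < k" "j < k" for i j
      unfolding x_def using f_mult[OF yD yD] y_comm that by metis
    show "inj_on x {..<k}" using x_neq by (auto simp: inj_on_def)
  qed
  then have "2 ^ (k - 1) * fact k \<le> card (carrier G)"
    using totally_symmetric.card_ge G(2) by blast
  then show ?thesis by (simp add: k_def numeral_2_eq_2)
qed

end

section \<open>The braid group\<close>

lemma braid_valid_simps [simp]:
  "braid_valid n []"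
  "braid_valid n (x # w) \<longleftrightarrow> 1 \<le> fst x \<and> fst x < n \<and> braid_valid n w"
  "braid_valid n (u @ v) \<longleftrightarrow> braid_valid n u \<and> braid_valid n v"
  by (auto simp: braid_valid_def)

lemma braid_eq_valid: "braid_eq n u v \<Longrightarrow> braid_valid n u \<and> braid_valid n v"
  by (induction rule: braid_eq.induct) auto

lemma braid_eq_append:
  assumes "braid_eq n u u'" "braid_eq n v v'"
  shows "braid_eq n (u @ v) (u' @ v')"
proof -
  have "braid_eq n ([] @ u @ v) ([] @ u' @ v)"
    by (rule braid_eq.ctxt[OF assms(1)]) (use braid_eq_valid[OF assms(2)] in auto)
  moreover have "braid_eq n (u' @ v @ []) (u' @ v' @ [])"
    by (rule braid_eq.ctxt[OF assms(2)]) (use braid_eq_valid[OF assms(1)] in auto)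
  ultimately show ?thesis using braid_eq.trans[of n "u @ v" "u' @ v" "u' @ v'"] by simp
qed

lemma braid_class_eqI: "braid_eq n u v \<Longrightarrow> braid_class n u = braid_class n v"
  unfolding braid_class_def using braid_eq.sym braid_eq.trans by blast

lemma braid_class_closed: "braid_valid n w \<Longrightarrow> braid_class n w \<in> carrier (braid_group n)"
  by (auto simp: braid_group_def)

lemma braid_class_mult:
  assumes "braid_valid n u" "braid_valid n v"
  shows "braid_class n u \<otimes>\<^bsub>braid_group n\<^esub> braid_class n v = braid_class n (u @ v)"
proof -
  have "(\<exists>u'. braid_eq n u u' \<and> (\<exists>v'. braid_eq n v v' \<and> braid_eq n (u' @ v') w)) \<longleftrightarrow> braid_eq n (u @ v) w" for w
  proof (intro iffI)
    assume "braid_eq n (u @ v) w"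
    then show "\<exists>u'. braid_eq n u u' \<and> (\<exists>v'. braid_eq n v v' \<and> braid_eq n (u' @ v') w)"
      using braid_eq.refl[OF assms(1)] braid_eq.refl[OF assms(2)] by blast
  qed (blast intro: braid_eq.trans[OF braid_eq_append])
  then show ?thesis by (simp add: braid_group_def braid_class_def Bex_def)
qed

lemma braid_class_one: "\<one>\<^bsub>braid_group n\<^esub> = braid_class n []"
  by (simp add: braid_group_def)

lemma braid_group_carrierE:
  assumes "a \<in> carrier (braid_group n)"
  obtains w where "braid_valid n w" "a = braid_class n w"
  using assms by (auto simp: braid_group_def)

text \<open>The inverse word is \<open>w\<close> reversed with all signs flipped; it cancels against
  \<open>w\<close> from the middle outwards.\<close>

lemma braid_left_inverse:
  assumes "braid_valid n w"
  shows "\<exists>v. braid_valid n v \<and> braid_eq n (v @ w) []"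
  using assms
proof (induction w)
  case Nil
  then show ?case by (auto intro!: exI[of _ "[]"] braid_eq.refl)
next
  case (Cons x w)
  then obtain v where v: "braid_valid n v" "braid_eq n (v @ w) []" by auto
  obtain i e where x: "x = (i, e)" by fastforce
  have i: "1 \<le> i" "i < n" using Cons.prems x by auto
  have "braid_eq n [(i, \<not> e), (i, e)] []" using braid_eq.cancel[OF i, of "\<not> e"] by simp
  then have "braid_eq n (v @ [(i, \<not> e), (i, e)] @ w) (v @ [] @ w)"
    using v Cons.prems by (intro braid_eq.ctxt) auto
  then have "braid_eq n ((v @ [(i, \<not> e)]) @ x # w) []"
    using braid_eq.trans[OF _ v(2)] x by simp
  then show ?case using v i by (intro exI[of _ "v @ [(i, \<not> e)]"]) auto
qed

lemma group_braid_group: "group (braid_group n)"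
proof (rule groupI)
  fix a b c assume "a \<in> carrier (braid_group n)" "b \<in> carrier (braid_group n)" "c \<in> carrier (braid_group n)"
  then obtain u v w where "braid_valid n u" "braid_valid n v" "braid_valid n w"
    "a = braid_class n u" "b = braid_class n v" "c = braid_class n w"
    by (elim braid_group_carrierE)
  then show "a \<otimes>\<^bsub>braid_group n\<^esub> b \<otimes>\<^bsub>braid_group n\<^esub> c = a \<otimes>\<^bsub>braid_group n\<^esub> (b \<otimes>\<^bsub>braid_group n\<^esub> c)"
    by (simp add: braid_class_mult)
next
  fix a b assume "a \<in> carrier (braid_group n)" "b \<in> carrier (braid_group n)"
  then show "a \<otimes>\<^bsub>braid_group n\<^esub> b \<in> carrier (braid_group n)"
    by (elim braid_group_carrierE) (simp add: braid_class_mult braid_class_closed)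
next
  show "\<one>\<^bsub>braid_group n\<^esub> \<in> carrier (braid_group n)"
    by (simp add: braid_class_one braid_class_closed)
next
  fix a assume "a \<in> carrier (braid_group n)"
  then obtain w where w: "braid_valid n w" "a = braid_class n w" by (rule braid_group_carrierE)
  then show "\<one>\<^bsub>braid_group n\<^esub> \<otimes>\<^bsub>braid_group n\<^esub> a = a"
    by (simp add: braid_class_one braid_class_mult)
  obtain v where "braid_valid n v" "braid_eq n (v @ w) []" using braid_left_inverse w by blast
  then show "\<exists>b\<in>carrier (braid_group n). b \<otimes>\<^bsub>braid_group n\<^esub> a = \<one>\<^bsub>braid_group n\<^esub>"
    using w by (intro bexI[of _ "braid_class n v"])
      (simp_all add: braid_class_one braid_class_mult braid_class_closed braid_class_eqI)
qed

lemma braid_class_in_generate: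
  assumes "braid_valid n w"
  shows "braid_class n w \<in> generate (braid_group n) ((\<lambda>i. braid_class n [(i, True)]) ` {1..<n})"
  using assms
proof (induction w)
  case Nil
  then show ?case using generate.one braid_class_one by metis
next
  case (Cons x w)
  interpret group "braid_group n" by (rule group_braid_group)
  obtain i e where x: "x = (i, e)" by fastforce
  have i: "1 \<le> i" "i < n" using Cons.prems x by auto
  have valid: "braid_valid n [(i, b)]" for b using i by simp
  let ?S = "(\<lambda>i. braid_class n [(i, True)]) ` {1..<n}"
  \<comment> \<open>A negative letter represents the inverse of the positive one, so the positive
    letters already generate.\<close>
  have "braid_class n [(i, False)] \<otimes>\<^bsub>braid_group n\<^esub> braid_class n [(i, True)] = \<one>\<^bsub>braid_group n\<^esub>"
    using braid_class_mult[OF valid valid] braid_class_eqI[OF braid_eq.cancel[OF i, of False]]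
    by (simp add: braid_class_one)
  then have "inv\<^bsub>braid_group n\<^esub> braid_class n [(i, True)] = braid_class n [(i, False)]"
    by (rule inv_equality) (use valid braid_class_closed in auto)
  moreover have "braid_class n [(i, True)] \<in> ?S" using i by auto
  ultimately have "braid_class n [(i, b)] \<in> generate (braid_group n) ?S" for b
    using generate.inv[of "braid_class n [(i, True)]" ?S "braid_group n"]
    by (cases b) (auto intro: generate.incl)
  moreover have "braid_class n (x # w) = braid_class n [(i, e)] \<otimes>\<^bsub>braid_group n\<^esub> braid_class n w"
    using braid_class_mult[OF valid, of w] Cons.prems x by simp
  ultimately show ?case using Cons by (simp add: generate.eng)
qed

lemma artin_group_braid_group: "artin_group (braid_group n) (\<lambda>i. braid_class n [(i, True)]) n"
proof (intro artin_group.intro artin_group_axioms.intro group_braid_group)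
  interpret group "braid_group n" by (rule group_braid_group)
  let ?S = "(\<lambda>i. braid_class n [(i, True)]) ` {1..<n}"
  have "?S \<subseteq> carrier (braid_group n)" by (auto intro!: braid_class_closed)
  then show "carrier (braid_group n) = generate (braid_group n) ?S"
    using generate_in_carrier braid_class_in_generate by (auto elim!: braid_group_carrierE)
qed (auto simp: braid_class_mult intro!: braid_class_closed braid_class_eqI
    braid_eq.far braid_eq.adj[simplified])

theorem theorem1p2:
  fixes n :: nat and G :: "('g, 'b) monoid_scheme" and f :: "braid_word set \<Rightarrow> 'g"
  assumes "n \<ge> 5"
    and "group G" and "finite (carrier G)"
    and "f \<in> hom (braid_commutator_group n) G"
    and "\<exists>x \<in> carrier (braid_commutator_group n). f x \<noteq> \<one>\<^bsub>G\<^esub>"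
  shows "card (carrier G) \<ge> 2 ^ (n div 2 - 2) * fact (n div 2 - 1)"
proof -
  interpret artin_group "braid_group n" "\<lambda>i. braid_class n [(i, True)]" n
    by (rule artin_group_braid_group)
  show ?thesis
    using assms card_ge_of_nontrivial_hom[of G f] by (simp add: braid_commutator_group_def)
qed

end
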